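(* Consider the decoupled system ($\gamma=0$, $\Phi=0$) with $K$ agents and suppose a hidden drift $h\in\mathbb R^d$ is added to every agent's dynamics, so that the true drift of agent $k$ is $\mu^k(W^k)=-\alpha_{\mathrm{self}}W^k+h$, i.e. $$dW^k_t=(-\alpha_{\mathrm{self}}W^k_t+h)\,dt+\sigma_0\,dB^k_t,\qquad k=1,\dots,K.$$ Define the honest noise floor $V^\infty_{\mathrm{hon}}=Kd\sigma_0^2/(4\alpha_{\mathrm{self}})$. If the drift magnitude satisfies $$\frac{K}{2\alpha_{\mathrm{self}}^2}\lVert h\rVert^2=\delta\cdot V^\infty_{\mathrm{hon}}\qquad\text{with}\qquad 0<\delta<\frac{\theta_{\mathrm{ind}}}{V^\infty_{\mathrm{hon}}/K}-1,$$ then: (i) No individual agent is flagged: for every $k$, $\mathbb E_\pi[V^k]<\theta_{\mathrm{ind}}$. (ii) The joint monitor flags the system: $V_{\mathrm{joint}}=\sum_{k=1}^K\mathbb E_\pi[V^k]>(1+\delta/2)\cdot V^\infty_{\mathrm{hon}}$.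
   Context: $K\ge 2$ and $d\ge1$ are integers; $\alpha_{\mathrm{self}}>0$, $\sigma_0>0$ are real constants. $B^1,\dots,B^K$ are mutually independent standard $d$-dimensional Brownian motions on a complete filtered probability space satisfying the usual conditions. The state is $\mathbf W_t=(W^1_t,\dots,W^K_t)\in\mathbb R^{dK}$; the per-agent Lyapunov function is $V^k(\mathbf W)=\tfrac12\lVert W^k\rVert^2$, with $\lVert\cdot\rVert$ the Euclidean norm. $\pi$ is the stationary distribution of the process with the hidden drift $h$, and $\mathbb E_\pi^{\mathrm{honest}}$ is the expectation under the stationary distribution of the same system without drift ($h=0$). The individual threshold is $\theta_{\mathrm{ind}}=2\,\mathbb E_\pi^{\mathrm{honest}}[V^k]$ (the same for every $k$); agent $k$ is flagged by the individual monitor if $\mathbb E_\pi[V^k]>\theta_{\mathrm{ind}}$. The joint monitor flags the system when $V_{\mathrm{joint}}$ exceeds the joint threshold $(1+\delta/2)V^\infty_{\mathrm{hon}}$. *)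

theory Defs
  imports "HOL-Probability.Probability"
begin

text \<open>Time is the half-line of nonnegative reals; the values of \<open>F\<close>, \<open>B\<close> and \<open>W\<close> at negative
  times are irrelevant.\<close>

definition usual_filtered_prob_space :: "'a measure \<Rightarrow> (real \<Rightarrow> 'a measure) \<Rightarrow> bool" where
  "usual_filtered_prob_space M F \<longleftrightarrow>
     prob_space M \<and> complete_measure M \<and>
     (\<forall>t\<ge>0. subalgebra M (F t)) \<and>
     (\<forall>s t. 0 \<le> s \<longrightarrow> s \<le> t \<longrightarrow> sets (F s) \<subseteq> sets (F t)) \<and>
     (\<forall>t\<ge>0. sets (F t) = (\<Inter>s\<in>{t<..}. sets (F s))) \<and>
     null_sets M \<subseteq> sets (F 0)"

text \<open>The last two conjuncts express that the increment has distribution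
  \<open>N(0, (t - s) I)\<close>; the second argument of \<open>normal_density\<close> is the standard deviation.\<close>

definition standard_brownian_motion ::
  "'a measure \<Rightarrow> (real \<Rightarrow> 'a measure) \<Rightarrow> (real \<Rightarrow> 'a \<Rightarrow> real ^ 'd) \<Rightarrow> bool" where
  "standard_brownian_motion M F B \<longleftrightarrow>
     (\<forall>t\<ge>0. B t \<in> borel_measurable (F t)) \<and>
     (AE \<omega> in M. B 0 \<omega> = 0) \<and>
     (AE \<omega> in M. continuous_on {0..} (\<lambda>t. B t \<omega>)) \<and>
     (\<forall>s t. 0 \<le> s \<longrightarrow> s < t \<longrightarrow>
        prob_space.indep_set M (sets (F s))
          (sets (vimage_algebra (space M) (\<lambda>\<omega>. B t \<omega> - B s \<omega>) borel)) \<and>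
        prob_space.indep_vars M (\<lambda>_. borel) (\<lambda>i \<omega>. (B t \<omega> - B s \<omega>) $ i) UNIV \<and>
        (\<forall>i. distributed M lborel (\<lambda>\<omega>. (B t \<omega> - B s \<omega>) $ i) (normal_density 0 (sqrt (t - s)))))"

text \<open>Mutual independence of the processes, as random elements of the space of paths.\<close>

definition independent_processes ::
  "'a measure \<Rightarrow> ('k \<Rightarrow> real \<Rightarrow> 'a \<Rightarrow> real ^ 'd) \<Rightarrow> bool" where
  "independent_processes M B \<longleftrightarrow>
     prob_space.indep_vars M (\<lambda>_. PiM {0..} (\<lambda>_. borel)) (\<lambda>k \<omega>. \<lambda>t\<in>{0..}. B k t \<omega>) UNIV"

text \<open>A state is a vector \<open>w :: real ^ 'd ^ 'k\<close>, with \<open>w $ k\<close> the state of agent \<open>k\<close>.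
  The following is the integral form of
  \<open>dW\<^sup>k = \<mu> (W\<^sup>k) dt + \<sigma> dB\<^sup>k\<close>, \<open>W\<^sup>k 0 = w0 $ k\<close>, for all \<open>k\<close>. Since \<open>\<sigma>\<close> is constant, the
  stochastic integral of \<open>\<sigma>\<close> over \<open>[0, t]\<close> is \<open>\<sigma> (B\<^sup>k t - B\<^sup>k 0)\<close>.\<close>

definition decoupled_sde_solution ::
  "'a measure \<Rightarrow> (real \<Rightarrow> 'a measure) \<Rightarrow> ('k \<Rightarrow> real \<Rightarrow> 'a \<Rightarrow> real ^ 'd) \<Rightarrow>
   (real ^ 'd \<Rightarrow> real ^ 'd) \<Rightarrow> real \<Rightarrow> real ^ 'd ^ 'k \<Rightarrow> (real \<Rightarrow> 'a \<Rightarrow> real ^ 'd ^ 'k) \<Rightarrow> bool" where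
  "decoupled_sde_solution M F B \<mu> \<sigma> w0 W \<longleftrightarrow>
     (\<forall>t\<ge>0. W t \<in> borel_measurable (F t)) \<and>
     (AE \<omega> in M. continuous_on {0..} (\<lambda>t. W t \<omega>)) \<and>
     (AE \<omega> in M. \<forall>t\<ge>0. \<forall>k.
        W t \<omega> $ k = w0 $ k + integral {0..t} (\<lambda>s. \<mu> (W s \<omega> $ k)) + \<sigma> *\<^sub>R (B k t \<omega> - B k 0 \<omega>))"

text \<open>\<open>W x\<close> is the process started at the state \<open>x\<close>, so its transition probabilities are
  \<open>P t x A = Pr (W x t \<in> A)\<close>, and \<open>\<pi>\<close> is stationary when \<open>\<pi> P t = \<pi>\<close> for all \<open>t \<ge> 0\<close>.\<close>

definition stationary_distribution ::
  "'a measure \<Rightarrow> ('s \<Rightarrow> real \<Rightarrow> 'a \<Rightarrow> 's::topological_space) \<Rightarrow> 's measure \<Rightarrow> bool" where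
  "stationary_distribution M W \<pi> \<longleftrightarrow>
     prob_space \<pi> \<and> sets \<pi> = sets borel \<and>
     (\<forall>t\<ge>0. \<forall>A\<in>sets borel.
        emeasure \<pi> A = (\<integral>\<^sup>+ x. emeasure M {\<omega> \<in> space M. W x t \<omega> \<in> A} \<partial>\<pi>))"

definition lyapunov :: "'k \<Rightarrow> real ^ 'd ^ 'k \<Rightarrow> real" where
  "lyapunov k w = 1/2 * (norm (w $ k))\<^sup>2"

definition V_joint :: "(real ^ 'd ^ 'k) measure \<Rightarrow> real" where
  "V_joint \<pi> = (\<Sum>k\<in>UNIV. \<integral>w. lyapunov k w \<partial>\<pi>)"

definition honest_noise_floor :: "nat \<Rightarrow> nat \<Rightarrow> real \<Rightarrow> real \<Rightarrow> real" where
  "honest_noise_floor K d \<alpha> \<sigma> = real K * real d * \<sigma>\<^sup>2 / (4 * \<alpha>)"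

end

theory Submission
  imports Defs
begin

text \<open>
  The drift \<open>- \<alpha> w + h\<close> turns every coordinate of every agent into a scalar Ornstein-Uhlenbeck
  process with mean level \<open>h\<^sub>i / \<alpha>\<close>, whose stationary second moment is
  \<open>(h\<^sub>i / \<alpha>)\<^sup>2 + \<sigma>\<^sup>2 / (2 \<alpha>)\<close>. Summing over coordinates
  (\<open>stationary_lyapunov_expectation\<close>) gives each agent the energy
  \<open>\<parallel>h\<parallel>\<^sup>2 / (2 \<alpha>\<^sup>2) + d \<sigma>\<^sup>2 / (4 \<alpha>) = (1 + \<delta>) V\<^sub>h\<^sub>o\<^sub>n / K\<close>: the drift adds exactly the fraction
  \<open>\<delta>\<close> of the noise floor. The upper bound on \<open>\<delta>\<close> says that this stays below the individual
  threshold, while the sum over the agents is \<open>(1 + \<delta>) V\<^sub>h\<^sub>o\<^sub>n > (1 + \<delta>/2) V\<^sub>h\<^sub>o\<^sub>n\<close>.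

  The stationary second moment is found without identifying the stationary law or integrating
  stochastically. Two solutions driven by the same noise differ by a solution of \<open>D' = - \<alpha> D\<close>
  (\<open>linear_integral_equation_solution\<close>), so the solution started at \<open>x\<close> is almost surely
  \<open>exp (- \<alpha> t) x + Z\<^sub>t\<close>, where \<open>Z\<close> is the solution started at \<open>0\<close>. Stationarity therefore says
  that the coordinate law \<open>N\<close> is a fixed point of \<open>X \<mapsto> a X + Z\<close>, where \<open>a = exp (- \<alpha> t)\<close> and \<open>Z = Z\<^sub>t\<close>
  is independent of \<open>X\<close>. Since \<open>a < 1\<close>, a truncation argument shows that \<open>N\<close> has a second moment
  (\<open>affine_stationary_square_integrable\<close>), and expanding \<open>a X + Z\<close> and its square gives
  \<open>(1 - a) E X = E Z\<close> and \<open>(1 - a\<^sup>2) E X\<^sup>2 = 2 a (E X) (E Z) + E Z\<^sup>2\<close>. These identities hold for all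
  small \<open>t > 0\<close>; dividing by \<open>t\<close> and letting \<open>t\<close> tend to \<open>0\<close> requires only
  \<open>E Z\<^sub>t = t h + o(t)\<close> and \<open>E Z\<^sub>t\<^sup>2 = t \<sigma>\<^sup>2 + o(t)\<close>, and yields \<open>\<alpha> E X = h\<close> and
  \<open>2 \<alpha> E X\<^sup>2 = 2 h E X + \<sigma>\<^sup>2\<close>. The small-time expansion holds because
  \<open>Z\<^sub>t = \<sigma> B\<^sub>t + t h - \<alpha> \<integral>\<^sub>0\<^sup>t Z\<close> and the last integral has second moment \<open>O(t\<^sup>3)\<close>
  (\<open>drifted_integral_second_moment\<close>).
\<close>

section \<open>Scalar linear integral equations\<close>

text \<open>The equation forces \<open>exp (\<alpha> t) D t\<close> to be constant. It is applied to the difference of two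
  solutions driven by the same noise, in which the noise cancels.\<close>

lemma linear_integral_equation_solution:
  fixes D :: "real \<Rightarrow> real"
  assumes cont: "continuous_on {0..} D"
    and eq: "\<And>t. t \<ge> 0 \<Longrightarrow> D t = c - \<alpha> * integral {0..t} D"
    and "T \<ge> 0"
  shows "D T = exp (- \<alpha> * T) * c"
proof -
  define u where "u = (\<lambda>t. integral {0..t} D)"
  have u: "(u has_real_derivative c - \<alpha> * u s) (at s within {0..T})" if "s \<in> {0..T}" for s
  proof -
    have "(u has_real_derivative D s) (at s within {0..T})"
      unfolding u_def using that
      by (intro integral_has_real_derivative continuous_on_subset[OF cont]) auto
    with eq[of s] that show ?thesis by (simp add: u_def)
  qed
  have "\<exists>k. \<forall>s\<in>{0..T}. exp (\<alpha> * s) * (c - \<alpha> * u s) = k"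
    by (rule has_field_derivative_zero_constant)
      (auto intro!: derivative_eq_intros u simp: algebra_simps)
  then obtain k where k: "\<And>s. s \<in> {0..T} \<Longrightarrow> exp (\<alpha> * s) * (c - \<alpha> * u s) = k" by blast
  have "exp (\<alpha> * T) * D T = c"
    using k[of 0] k[of T] \<open>T \<ge> 0\<close> eq[OF \<open>T \<ge> 0\<close>] by (simp add: u_def)
  then show ?thesis by (auto simp: exp_minus field_simps)
qed

text \<open>The exponent \<open>1\<close> of \<open>T\<close> in front of the integral is what later produces the order \<open>T\<^sup>3\<close>. With
  \<open>u t = \<integral>\<^sub>0\<^sup>t z\<close> one has \<open>u' = g - \<alpha> u\<close>; the damping only decreases \<open>u\<^sup>2\<close>, and
  \<open>2 u g \<le> u\<^sup>2 / T + T g\<^sup>2\<close>. The weight \<open>exp (- s / T)\<close> absorbs the term \<open>u\<^sup>2 / T\<close> and costs no more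
  than the factor \<open>exp 1\<close> on \<open>[0, T]\<close>.\<close>
lemma damped_integral_square_bound:
  fixes z g :: "real \<Rightarrow> real"
  assumes "\<alpha> \<ge> 0" "T > 0" and z: "continuous_on {0..T} z" and g: "continuous_on {0..T} g"
    and eq: "\<And>t. t \<in> {0..T} \<Longrightarrow> z t = - \<alpha> * integral {0..t} z + g t"
  shows "(integral {0..T} z)\<^sup>2 \<le> exp 1 * T * integral {0..T} (\<lambda>s. (g s)\<^sup>2)"
proof -
  define u where "u = (\<lambda>t. integral {0..t} z)"
  have u: "(u has_real_derivative z s) (at s within {0..T})" if "s \<in> {0..T}" for s
    unfolding u_def using that by (intro integral_has_real_derivative z) auto
  define \<phi> where "\<phi> = (\<lambda>s. exp (- s / T) * (u s)\<^sup>2)"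
  define \<phi>' where "\<phi>' = (\<lambda>s. exp (- s / T) * (2 * u s * z s - (u s)\<^sup>2 / T))"
  have "(\<phi>' has_integral (\<phi> T - \<phi> 0)) {0..T}"
  proof (rule fundamental_theorem_of_calculus)
    fix s assume "s \<in> {0..T}"
    then have "(\<phi> has_real_derivative \<phi>' s) (at s within {0..T})"
      unfolding \<phi>_def \<phi>'_def using \<open>T > 0\<close>
      by (auto intro!: derivative_eq_intros u simp: field_simps power2_eq_square)
    then show "(\<phi> has_vector_derivative \<phi>' s) (at s within {0..T})"
      by (simp add: has_real_derivative_iff_has_vector_derivative)
  qed (use \<open>T > 0\<close> in auto)
  moreover have "((\<lambda>s. T * (g s)\<^sup>2) has_integral T * integral {0..T} (\<lambda>s. (g s)\<^sup>2)) {0..T}"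
    by (intro has_integral_mult_right integrable_integral integrable_continuous_interval
        continuous_intros g)
  moreover have "\<phi>' s \<le> T * (g s)\<^sup>2" if s: "s \<in> {0..T}" for s
  proof -
    have "2 * u s * z s = 2 * u s * g s - 2 * (\<alpha> * (u s)\<^sup>2)"
      by (subst eq[OF s]) (simp add: u_def power2_eq_square algebra_simps)
    moreover have "0 \<le> \<alpha> * (u s)\<^sup>2" using \<open>\<alpha> \<ge> 0\<close> by simp
    ultimately have "2 * u s * z s - (u s)\<^sup>2 / T \<le> 2 * u s * g s - (u s)\<^sup>2 / T"
      by linarith
    also have "\<dots> = T * (g s)\<^sup>2 - (u s - T * g s)\<^sup>2 / T"
      using \<open>T > 0\<close> by (simp add: field_simps power2_eq_square)
    also have "\<dots> \<le> T * (g s)\<^sup>2" using \<open>T > 0\<close> by simp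
    finally have *: "2 * u s * z s - (u s)\<^sup>2 / T \<le> T * (g s)\<^sup>2" .
    have "\<phi>' s \<le> exp (- s / T) * (T * (g s)\<^sup>2)"
      unfolding \<phi>'_def by (intro mult_left_mono *) auto
    also have "\<dots> \<le> 1 * (T * (g s)\<^sup>2)"
      using s \<open>T > 0\<close> by (intro mult_right_mono) auto
    finally show ?thesis by simp
  qed
  ultimately have "\<phi> T - \<phi> 0 \<le> T * integral {0..T} (\<lambda>s. (g s)\<^sup>2)"
    by (rule has_integral_le)
  then have "exp (- 1) * (u T)\<^sup>2 \<le> T * integral {0..T} (\<lambda>s. (g s)\<^sup>2)"
    using \<open>T > 0\<close> by (simp add: \<phi>_def u_def)
  then show ?thesis by (simp add: u_def exp_minus field_simps)
qed

section \<open>Exchanging expectation and time integral\<close>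
lemma grid_floor_tendsto:
  fixes s :: real
  assumes "s \<ge> 0"
  shows "(\<lambda>n. real (nat \<lfloor>real (Suc n) * s\<rfloor>) / real (Suc n)) \<longlonglongrightarrow> s"
proof (rule tendsto_sandwich)
  show "\<forall>\<^sub>F n in sequentially. s - 1 / real (Suc n) \<le> real (nat \<lfloor>real (Suc n) * s\<rfloor>) / real (Suc n)"
  proof (intro always_eventually allI)
    fix n
    have "real (Suc n) * s - 1 \<le> real (nat \<lfloor>real (Suc n) * s\<rfloor>)" by linarith
    then have "(real (Suc n) * s - 1) / real (Suc n) \<le>
        real (nat \<lfloor>real (Suc n) * s\<rfloor>) / real (Suc n)"
      by (rule divide_right_mono) simp
    then show "s - 1 / real (Suc n) \<le> real (nat \<lfloor>real (Suc n) * s\<rfloor>) / real (Suc n)"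
      by (simp add: diff_divide_distrib)
  qed
  show "\<forall>\<^sub>F n in sequentially. real (nat \<lfloor>real (Suc n) * s\<rfloor>) / real (Suc n) \<le> s"
  proof (intro always_eventually allI)
    fix n
    have "0 \<le> real (Suc n) * s" using assms by simp
    then have "real (nat \<lfloor>real (Suc n) * s\<rfloor>) \<le> real (Suc n) * s" by linarith
    then show "real (nat \<lfloor>real (Suc n) * s\<rfloor>) / real (Suc n) \<le> s"
      by (simp add: field_simps)
  qed
  show "(\<lambda>n. s - 1 / real (Suc n)) \<longlonglongrightarrow> s"
    using tendsto_diff[OF tendsto_const[of s] LIMSEQ_inverse_real_of_nat]
    by (simp add: inverse_eq_divide)
qed simp

text \<open>Tonelli's theorem needs joint measurability in time and chance, which is not immediate: each
  \<open>X t\<close> is measurable, and the paths are continuous only almost surely. Sampling \<open>X\<close> at the grid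
  point \<open>\<lfloor>n s\<rfloor> / n\<close> gives a jointly measurable process, because the grid is countable, and the
  lower limit of these samplings agrees with \<open>X\<close> on every continuous path.\<close>
lemma (in sigma_finite_measure) nn_integral_time_integral:
  fixes X :: "real \<Rightarrow> 'a \<Rightarrow> real"
  assumes meas: "\<And>t. t \<ge> 0 \<Longrightarrow> X t \<in> borel_measurable M"
    and cont: "AE \<omega> in M. continuous_on {0..} (\<lambda>t. X t \<omega>)"
    and nonneg: "\<And>t \<omega>. X t \<omega> \<ge> 0"
  shows "(\<integral>\<^sup>+\<omega>. ennreal (integral {0..T} (\<lambda>s. X s \<omega>)) \<partial>M) =
    (\<integral>\<^sup>+s\<in>{0..T}. (\<integral>\<^sup>+\<omega>. ennreal (X s \<omega>) \<partial>M) \<partial>lborel)"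
proof -
  interpret P: pair_sigma_finite lborel M ..
  define grid :: "nat \<Rightarrow> real \<Rightarrow> nat" where "grid n s = nat \<lfloor>real (Suc n) * s\<rfloor>" for n s
  define G where "G s \<omega> = liminf (\<lambda>n. ennreal (X (real (grid n s) / real (Suc n)) \<omega>))" for s \<omega>
  have G_meas[measurable]: "case_prod G \<in> borel_measurable (lborel \<Otimes>\<^sub>M M)"
  proof -
    have "(\<lambda>p. ennreal (X (real (grid n (fst p)) / real (Suc n)) (snd p)))
        \<in> borel_measurable (lborel \<Otimes>\<^sub>M M)" for n
    proof (rule measurable_compose_countable[where g = "\<lambda>p. grid n (fst p)"
          and f = "\<lambda>i p. ennreal (X (real i / real (Suc n)) (snd p))"])
      show "(\<lambda>p. ennreal (X (real i / real (Suc n)) (snd p))) \<in> borel_measurable (lborel \<Otimes>\<^sub>M M)" for i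
        using meas[of "real i / real (Suc n)"] by simp
      show "(\<lambda>p. grid n (fst p)) \<in> measurable (lborel \<Otimes>\<^sub>M M) (count_space UNIV)"
        unfolding grid_def by measurable
    qed
    then show ?thesis unfolding G_def split_beta by (rule borel_measurable_liminf)
  qed
  have G_eq: "G s \<omega> = ennreal (X s \<omega>)" if "continuous_on {0..} (\<lambda>t. X t \<omega>)" "s \<ge> 0" for s \<omega>
  proof -
    have "(\<lambda>n. X (real (grid n s) / real (Suc n)) \<omega>) \<longlonglongrightarrow> X s \<omega>"
      unfolding grid_def
      by (rule continuous_on_tendsto_compose[OF that(1) grid_floor_tendsto]) (use that(2) in auto)
    then show ?thesis unfolding G_def by (intro lim_imp_Liminf tendsto_ennrealI) auto
  qed
  have "(\<integral>\<^sup>+\<omega>. ennreal (integral {0..T} (\<lambda>s. X s \<omega>)) \<partial>M) =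
      (\<integral>\<^sup>+\<omega>. (\<integral>\<^sup>+s. G s \<omega> * indicator {0..T} s \<partial>lborel) \<partial>M)"
  proof (rule nn_integral_cong_AE, use cont in eventually_elim)
    fix \<omega> assume c: "continuous_on {0..} (\<lambda>t. X t \<omega>)"
    have "set_integrable lborel {0..T} (\<lambda>s. X s \<omega>)"
      by (intro borel_integrable_atLeastAtMost' continuous_on_subset[OF c]) auto
    then have "integral {0..T} (\<lambda>s. X s \<omega>) = (LINT s:{0..T}|lborel. X s \<omega>)"
      and "integrable lborel (\<lambda>s. indicator {0..T} s * X s \<omega>)"
      by (simp_all add: set_borel_integral_eq_integral set_integrable_def)
    then have "ennreal (integral {0..T} (\<lambda>s. X s \<omega>)) =
        (\<integral>\<^sup>+s. ennreal (indicator {0..T} s * X s \<omega>) \<partial>lborel)"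
      by (subst nn_integral_eq_integral) (auto simp: nonneg set_lebesgue_integral_def)
    also have "\<dots> = (\<integral>\<^sup>+s. G s \<omega> * indicator {0..T} s \<partial>lborel)"
      by (rule nn_integral_cong) (auto simp: G_eq[OF c] split: split_indicator)
    finally show "ennreal (integral {0..T} (\<lambda>s. X s \<omega>)) =
        (\<integral>\<^sup>+s. G s \<omega> * indicator {0..T} s \<partial>lborel)" .
  qed
  also have "\<dots> = (\<integral>\<^sup>+s. (\<integral>\<^sup>+\<omega>. G s \<omega> * indicator {0..T} s \<partial>M) \<partial>lborel)"
    by (rule P.Fubini') measurable
  also have "\<dots> = (\<integral>\<^sup>+s\<in>{0..T}. (\<integral>\<^sup>+\<omega>. ennreal (X s \<omega>) \<partial>M) \<partial>lborel)"
  proof (rule nn_integral_cong)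
    fix s :: real
    show "(\<integral>\<^sup>+\<omega>. G s \<omega> * indicator {0..T} s \<partial>M) =
        (\<integral>\<^sup>+\<omega>. ennreal (X s \<omega>) \<partial>M) * indicator {0..T} s"
    proof (cases "s \<in> {0..T}")
      case True
      then have "(\<integral>\<^sup>+\<omega>. G s \<omega> \<partial>M) = (\<integral>\<^sup>+\<omega>. ennreal (X s \<omega>) \<partial>M)"
        using cont by (intro nn_integral_cong_AE) (auto elim!: eventually_mono simp: G_eq)
      with True show ?thesis by simp
    qed simp
  qed
  finally show ?thesis .
qed

section \<open>Laws that are invariant under a random affine contraction\<close>

text \<open>Convexity gives \<open>(a x + z)\<^sup>2 \<le> a x\<^sup>2 + z\<^sup>2 / (1 - a)\<close>. Integrating it directly would need the very
  moment in question, so both sides are truncated at level \<open>n\<close>. Invariance then bounds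
  \<open>E (min X\<^sup>2 n - min (a X\<^sup>2) n)\<close> uniformly in \<open>n\<close>, and the integrand is nonnegative and tends to
  \<open>(1 - a) X\<^sup>2\<close>, so that Fatou's lemma applies.\<close>
lemma affine_stationary_square_integrable:
  fixes N :: "real measure" and Z :: "'a \<Rightarrow> real"
  assumes "prob_space N" "prob_space M" and N: "sets N = sets borel"
    and [measurable]: "Z \<in> borel_measurable M" and Z2: "integrable M (\<lambda>\<omega>. (Z \<omega>)\<^sup>2)"
    and a: "0 \<le> a" "a < 1"
    and stat: "N = distr (N \<Otimes>\<^sub>M M) borel (\<lambda>(x, \<omega>). a * x + Z \<omega>)"
  shows "integrable N (\<lambda>x. x\<^sup>2)"
proof -
  interpret N: prob_space N by fact
  interpret M: prob_space M by fact
  note N[measurable_cong]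
  define C where "C = (\<integral>\<omega>. (Z \<omega>)\<^sup>2 / (1 - a) \<partial>M)"
  have C0: "0 \<le> C" unfolding C_def using a by (intro integral_nonneg_AE) auto
  have convex: "(a * x + z)\<^sup>2 \<le> a * x\<^sup>2 + z\<^sup>2 / (1 - a)" for x z :: real
  proof -
    have "a * x\<^sup>2 + z\<^sup>2 / (1 - a) - (a * x + z)\<^sup>2 = a * ((1 - a) * x - z)\<^sup>2 / (1 - a)"
      using a by (simp add: field_simps power2_eq_square)
    also have "\<dots> \<ge> 0" using a by simp
    finally show ?thesis by simp
  qed
  have int_min: "integrable N (\<lambda>x. min (c * x\<^sup>2) (real n))" if "0 \<le> c" for c n
    using that by (intro N.integrable_const_bound[where B = "real n"]) (auto simp: min_def)
  have bound: "(\<integral>x. min (x\<^sup>2) (real n) - min (a * x\<^sup>2) (real n) \<partial>N) \<le> C" for n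
  proof -
    have "ennreal (\<integral>x. min (1 * x\<^sup>2) (real n) \<partial>N) = (\<integral>\<^sup>+x. ennreal (min (x\<^sup>2) (real n)) \<partial>N)"
      using int_min[of 1 n] by (subst nn_integral_eq_integral) auto
    also have "\<dots> = (\<integral>\<^sup>+x. ennreal (min (x\<^sup>2) (real n))
        \<partial>distr (N \<Otimes>\<^sub>M M) borel (\<lambda>(x, \<omega>). a * x + Z \<omega>))"
      using stat by simp
    also have "\<dots> = (\<integral>\<^sup>+p. ennreal (min ((a * fst p + Z (snd p))\<^sup>2) (real n)) \<partial>(N \<Otimes>\<^sub>M M))"
      by (subst nn_integral_distr) (auto simp: split_beta)
    also have "\<dots> = (\<integral>\<^sup>+x. (\<integral>\<^sup>+\<omega>. ennreal (min ((a * x + Z \<omega>)\<^sup>2) (real n)) \<partial>M) \<partial>N)"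
      by (subst M.nn_integral_fst[symmetric]) auto
    also have "\<dots> \<le> (\<integral>\<^sup>+x. (\<integral>\<^sup>+\<omega>. ennreal (min (a * x\<^sup>2) (real n)) + ennreal ((Z \<omega>)\<^sup>2 / (1 - a)) \<partial>M) \<partial>N)"
    proof (intro nn_integral_mono)
      fix x \<omega>
      have "0 \<le> (Z \<omega>)\<^sup>2 / (1 - a)" using a by simp
      then have "min ((a * x + Z \<omega>)\<^sup>2) (real n) \<le> min (a * x\<^sup>2) (real n) + (Z \<omega>)\<^sup>2 / (1 - a)"
        using convex[of x "Z \<omega>"] by linarith
      then show "ennreal (min ((a * x + Z \<omega>)\<^sup>2) (real n)) \<le>
          ennreal (min (a * x\<^sup>2) (real n)) + ennreal ((Z \<omega>)\<^sup>2 / (1 - a))"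
        using a by (simp flip: ennreal_plus)
    qed
    also have "\<dots> = (\<integral>\<^sup>+x. ennreal (min (a * x\<^sup>2) (real n)) + ennreal C \<partial>N)"
    proof -
      have "(\<integral>\<^sup>+\<omega>. ennreal ((Z \<omega>)\<^sup>2 / (1 - a)) \<partial>M) = ennreal C"
        unfolding C_def using Z2 a by (intro nn_integral_eq_integral) auto
      then show ?thesis by (simp add: nn_integral_add M.emeasure_space_1)
    qed
    also have "\<dots> = ennreal (\<integral>x. min (a * x\<^sup>2) (real n) \<partial>N) + ennreal C"
      using int_min[of a n] a by (simp add: nn_integral_add N.emeasure_space_1 nn_integral_eq_integral)
    also have "\<dots> = ennreal ((\<integral>x. min (a * x\<^sup>2) (real n) \<partial>N) + C)"
      using C0 a by (intro ennreal_plus[symmetric] integral_nonneg_AE) auto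
    finally have "(\<integral>x. min (1 * x\<^sup>2) (real n) \<partial>N) \<le> (\<integral>x. min (a * x\<^sup>2) (real n) \<partial>N) + C"
      using C0 a by (subst (asm) ennreal_le_iff) (auto intro!: add_nonneg_nonneg integral_nonneg_AE)
    then show ?thesis using int_min[of 1 n] int_min[of a n] a by simp
  qed
  have "(\<integral>\<^sup>+x. ennreal ((1 - a) * x\<^sup>2) \<partial>N) =
      (\<integral>\<^sup>+x. liminf (\<lambda>n. ennreal (min (x\<^sup>2) (real n) - min (a * x\<^sup>2) (real n))) \<partial>N)"
  proof (rule nn_integral_cong)
    fix x :: real
    obtain m where m: "x\<^sup>2 \<le> real m" using real_arch_simple by blast
    have ax: "a * x\<^sup>2 \<le> x\<^sup>2" using a by (simp add: mult_left_le_one_le)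
    have "\<forall>\<^sub>F n in sequentially. min (x\<^sup>2) (real n) - min (a * x\<^sup>2) (real n) = (1 - a) * x\<^sup>2"
      using eventually_ge_at_top[of m]
    proof eventually_elim
      case (elim n)
      then have "x\<^sup>2 \<le> real n" using m by linarith
      then show ?case using ax by (simp add: min_def algebra_simps)
    qed
    then have "(\<lambda>n. min (x\<^sup>2) (real n) - min (a * x\<^sup>2) (real n)) \<longlonglongrightarrow> (1 - a) * x\<^sup>2"
      by (rule tendsto_eventually)
    then show "ennreal ((1 - a) * x\<^sup>2) =
        liminf (\<lambda>n. ennreal (min (x\<^sup>2) (real n) - min (a * x\<^sup>2) (real n)))"
      by (intro lim_imp_Liminf[symmetric] tendsto_ennrealI) auto
  qed
  also have "\<dots> \<le> liminf (\<lambda>n. \<integral>\<^sup>+x. ennreal (min (x\<^sup>2) (real n) - min (a * x\<^sup>2) (real n)) \<partial>N)"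
    by (intro nn_integral_liminf) measurable
  also have "\<dots> \<le> liminf (\<lambda>n::nat. ennreal C)"
  proof (intro Liminf_mono always_eventually allI)
    fix n
    have "min (a * x\<^sup>2) (real n) \<le> min (x\<^sup>2) (real n)" for x :: real
      using a mult_left_le_one_le[of "x\<^sup>2" a] by (intro min.mono) auto
    then have "(\<integral>\<^sup>+x. ennreal (min (x\<^sup>2) (real n) - min (a * x\<^sup>2) (real n)) \<partial>N) =
        ennreal (\<integral>x. min (x\<^sup>2) (real n) - min (a * x\<^sup>2) (real n) \<partial>N)"
      using int_min[of 1 n] int_min[of a n] a by (intro nn_integral_eq_integral) auto
    then show "(\<integral>\<^sup>+x. ennreal (min (x\<^sup>2) (real n) - min (a * x\<^sup>2) (real n)) \<partial>N) \<le> ennreal C"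
      using bound[of n] by (simp add: ennreal_leI)
  qed
  also have "\<dots> < \<infinity>" by (simp add: Liminf_const)
  finally have "integrable N (\<lambda>x. (1 - a) * x\<^sup>2)"
    using a by (intro integrableI_nonneg) auto
  then show ?thesis using a by simp
qed

text \<open>The mixed term of the second identity factorises because \<open>X\<close> and \<open>Z\<close> are independent under the
  product measure.\<close>
lemma affine_stationary_moments:
  fixes N :: "real measure" and Z :: "'a \<Rightarrow> real"
  assumes "prob_space N" "prob_space M" and N: "sets N = sets borel"
    and [measurable]: "Z \<in> borel_measurable M" and Z2: "integrable M (\<lambda>\<omega>. (Z \<omega>)\<^sup>2)"
    and X2: "integrable N (\<lambda>x. x\<^sup>2)"
    and stat: "N = distr (N \<Otimes>\<^sub>M M) borel (\<lambda>(x, \<omega>). a * x + Z \<omega>)"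
  shows "(1 - a) * (\<integral>x. x \<partial>N) = (\<integral>\<omega>. Z \<omega> \<partial>M)"
    and "(1 - a\<^sup>2) * (\<integral>x. x\<^sup>2 \<partial>N) = 2 * a * (\<integral>x. x \<partial>N) * (\<integral>\<omega>. Z \<omega> \<partial>M) + (\<integral>\<omega>. (Z \<omega>)\<^sup>2 \<partial>M)"
proof -
  interpret N: prob_space N by fact
  interpret M: prob_space M by fact
  interpret P: pair_sigma_finite N M ..
  note N[measurable_cong]
  have Z1: "integrable M Z" by (rule M.square_integrable_imp_integrable[OF _ Z2]) measurable
  have X1: "integrable N (\<lambda>x. x)" by (rule N.square_integrable_imp_integrable[OF _ X2]) measurable
  have push: "(\<integral>x. f x \<partial>N) = (\<integral>x. (\<integral>\<omega>. f (a * x + Z \<omega>) \<partial>M) \<partial>N)"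
    if [measurable]: "f \<in> borel_measurable borel" and f: "integrable N f" for f :: "real \<Rightarrow> real"
  proof -
    have "integrable (distr (N \<Otimes>\<^sub>M M) borel (\<lambda>(x, \<omega>). a * x + Z \<omega>)) f"
      using f stat by simp
    then have i: "integrable (N \<Otimes>\<^sub>M M) (\<lambda>p. f (a * fst p + Z (snd p)))"
      by (subst (asm) integrable_distr_eq) (auto simp: split_beta)
    have "(\<integral>x. f x \<partial>N) = (\<integral>x. f x \<partial>distr (N \<Otimes>\<^sub>M M) borel (\<lambda>(x, \<omega>). a * x + Z \<omega>))"
      using stat by simp
    also have "\<dots> = (\<integral>p. f (a * fst p + Z (snd p)) \<partial>(N \<Otimes>\<^sub>M M))"
      by (subst integral_distr) (auto simp: split_beta)
    also have "\<dots> = (\<integral>x. (\<integral>\<omega>. f (a * x + Z \<omega>) \<partial>M) \<partial>N)"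
      using P.integral_fst'[OF i] by simp
    finally show ?thesis .
  qed
  show "(1 - a) * (\<integral>x. x \<partial>N) = (\<integral>\<omega>. Z \<omega> \<partial>M)"
  proof -
    have "(\<integral>x. x \<partial>N) = (\<integral>x. (\<integral>\<omega>. a * x + Z \<omega> \<partial>M) \<partial>N)"
      by (rule push[OF _ X1]) simp
    also have "\<dots> = a * (\<integral>x. x \<partial>N) + (\<integral>\<omega>. Z \<omega> \<partial>M)"
      using Z1 X1 by (simp add: M.prob_space N.prob_space)
    finally show ?thesis unfolding left_diff_distrib by linarith
  qed
  have sq: "(a * x + Z \<omega>)\<^sup>2 = a\<^sup>2 * x\<^sup>2 + 2 * a * x * Z \<omega> + (Z \<omega>)\<^sup>2" for x \<omega>
    by (simp add: power2_eq_square algebra_simps)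
  have "(\<integral>x. x\<^sup>2 \<partial>N) = (\<integral>x. (\<integral>\<omega>. (a * x + Z \<omega>)\<^sup>2 \<partial>M) \<partial>N)"
    by (rule push[OF _ X2]) simp
  also have "\<dots> = (\<integral>x. a\<^sup>2 * x\<^sup>2 + 2 * a * x * (\<integral>\<omega>. Z \<omega> \<partial>M) + (\<integral>\<omega>. (Z \<omega>)\<^sup>2 \<partial>M) \<partial>N)"
    using Z1 Z2 by (simp add: sq M.prob_space)
  also have "\<dots> = a\<^sup>2 * (\<integral>x. x\<^sup>2 \<partial>N) + 2 * a * (\<integral>x. x \<partial>N) * (\<integral>\<omega>. Z \<omega> \<partial>M) + (\<integral>\<omega>. (Z \<omega>)\<^sup>2 \<partial>M)"
    using X1 X2 by (simp add: N.prob_space)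
  finally show "(1 - a\<^sup>2) * (\<integral>x. x\<^sup>2 \<partial>N) = 2 * a * (\<integral>x. x \<partial>N) * (\<integral>\<omega>. Z \<omega> \<partial>M) + (\<integral>\<omega>. (Z \<omega>)\<^sup>2 \<partial>M)"
    unfolding left_diff_distrib by linarith
qed


section \<open>Small-time moments of the process started at the origin\<close>
lemma (in prob_space) expectation_square_le:
  fixes X :: "'a \<Rightarrow> real"
  assumes "X \<in> borel_measurable M" "integrable M (\<lambda>\<omega>. (X \<omega>)\<^sup>2)"
  shows "(expectation X)\<^sup>2 \<le> expectation (\<lambda>\<omega>. (X \<omega>)\<^sup>2)"
  using variance_eq[of X] variance_positive[of X] square_integrable_imp_integrable[OF assms] assms(2)
  by simp

text \<open>Here \<open>b\<close> plays the Brownian coordinate, of size \<open>t\<^sup>1\<^sup>/\<^sup>2\<close> in the mean square, and \<open>u t\<close> the integral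
  of \<open>Z\<close> over \<open>[0, t]\<close>, of size at most \<open>t\<^sup>3\<^sup>/\<^sup>2\<close>. Consequently \<open>E u\<close>, \<open>E (b u)\<close> and \<open>E u\<^sup>2\<close> are all
  \<open>o(t)\<close>, whatever the joint law of \<open>b\<close> and \<open>u\<close>.\<close>
lemma (in prob_space) small_time_moments:
  fixes Z b u :: "real \<Rightarrow> 'a \<Rightarrow> real" and \<alpha> \<sigma> h C :: real
  assumes Z_eq: "\<And>t \<omega>. Z t \<omega> = \<sigma> * b t \<omega> + t * h - \<alpha> * u t \<omega>"
    and b_meas: "\<And>t. 0 < t \<Longrightarrow> b t \<in> borel_measurable M"
    and u_meas: "\<And>t. 0 < t \<Longrightarrow> u t \<in> borel_measurable M"
    and b2: "\<And>t. 0 < t \<Longrightarrow> integrable M (\<lambda>\<omega>. (b t \<omega>)\<^sup>2)"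
    and Eb: "\<And>t. 0 < t \<Longrightarrow> expectation (b t) = 0"
    and Eb2: "\<And>t. 0 < t \<Longrightarrow> expectation (\<lambda>\<omega>. (b t \<omega>)\<^sup>2) = t"
    and u2: "\<And>t. 0 < t \<Longrightarrow> t < 1 \<Longrightarrow> integrable M (\<lambda>\<omega>. (u t \<omega>)\<^sup>2)"
    and Eu2: "\<And>t. 0 < t \<Longrightarrow> t < 1 \<Longrightarrow> expectation (\<lambda>\<omega>. (u t \<omega>)\<^sup>2) \<le> C * t ^ 3"
  shows "\<And>t. 0 < t \<Longrightarrow> t < 1 \<Longrightarrow> integrable M (\<lambda>\<omega>. (Z t \<omega>)\<^sup>2)"
    and "((\<lambda>t. expectation (Z t) / t) \<longlongrightarrow> h) (at_right 0)"
    and "((\<lambda>t. expectation (\<lambda>\<omega>. (Z t \<omega>)\<^sup>2) / t) \<longlongrightarrow> \<sigma>\<^sup>2) (at_right 0)"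
proof -
  have near: "\<forall>\<^sub>F t in at_right (0::real). 0 < t \<and> t < 1"
    unfolding eventually_at_right_field by (rule exI[of _ 1]) auto
  have b1: "integrable M (b t)" if "0 < t" for t
    by (rule square_integrable_imp_integrable[OF b_meas b2]) (use that in auto)
  have u1: "integrable M (u t)" if "0 < t" "t < 1" for t
    by (rule square_integrable_imp_integrable[OF u_meas u2]) (use that in auto)
  have bu: "integrable M (\<lambda>\<omega>. b t \<omega> * u t \<omega>)" if t: "0 < t" "t < 1" for t
  proof (rule Bochner_Integration.integrable_bound)
    show "integrable M (\<lambda>\<omega>. (b t \<omega>)\<^sup>2 + (u t \<omega>)\<^sup>2)" using b2 u2 t by auto
    show "(\<lambda>\<omega>. b t \<omega> * u t \<omega>) \<in> borel_measurable M" using b_meas u_meas t by auto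
    have "\<bar>x * y\<bar> \<le> x\<^sup>2 + y\<^sup>2" for x y :: real
    proof -
      have "2 * \<bar>x * y\<bar> \<le> x\<^sup>2 + y\<^sup>2"
        using zero_le_power2[of "\<bar>x\<bar> - \<bar>y\<bar>"] by (simp add: power2_diff abs_mult)
      then show ?thesis by linarith
    qed
    then show "AE \<omega> in M. norm (b t \<omega> * u t \<omega>) \<le> norm ((b t \<omega>)\<^sup>2 + (u t \<omega>)\<^sup>2)" by simp
  qed
  have Z_sq: "(Z t \<omega>)\<^sup>2 = \<sigma>\<^sup>2 * (b t \<omega>)\<^sup>2 + t\<^sup>2 * h\<^sup>2 + \<alpha>\<^sup>2 * (u t \<omega>)\<^sup>2
      + 2 * \<sigma> * t * h * b t \<omega> - 2 * \<alpha> * \<sigma> * (b t \<omega> * u t \<omega>) - 2 * \<alpha> * t * h * u t \<omega>" for t \<omega>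
    unfolding Z_eq by (simp add: power2_eq_square algebra_simps)
  show Z2: "integrable M (\<lambda>\<omega>. (Z t \<omega>)\<^sup>2)" if "0 < t" "t < 1" for t
    unfolding Z_sq using that b1 b2 u1 u2 bu by simp
  have EZ: "expectation (Z t) = t * h - \<alpha> * expectation (u t)" if "0 < t" "t < 1" for t
    unfolding Z_eq using that b1 u1 Eb by (simp add: prob_space)
  have EZ2: "expectation (\<lambda>\<omega>. (Z t \<omega>)\<^sup>2) = \<sigma>\<^sup>2 * t + t\<^sup>2 * h\<^sup>2
      + \<alpha>\<^sup>2 * expectation (\<lambda>\<omega>. (u t \<omega>)\<^sup>2)
      - 2 * \<alpha> * \<sigma> * expectation (\<lambda>\<omega>. b t \<omega> * u t \<omega>) - 2 * \<alpha> * t * h * expectation (u t)"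
    if "0 < t" "t < 1" for t
    unfolding Z_sq using that b1 b2 u1 u2 bu Eb Eb2 by (simp add: prob_space)
  have u_lim: "((\<lambda>t. expectation (u t) / t) \<longlongrightarrow> 0) (at_right 0)"
  proof (rule Lim_null_comparison)
    show "\<forall>\<^sub>F t in at_right 0. norm (expectation (u t) / t) \<le> sqrt (C * t)"
      using near
    proof eventually_elim
      case (elim t)
      have "(expectation (u t))\<^sup>2 \<le> C * t ^ 3"
        using expectation_square_le[OF u_meas u2, of t] Eu2[of t] elim by linarith
      then have "(expectation (u t) / t)\<^sup>2 \<le> C * t"
        using elim by (simp add: power_divide field_simps power2_eq_square power3_eq_cube)
      then show ?case by (metis real_norm_def real_sqrt_abs real_sqrt_le_mono)
    qed
    show "((\<lambda>t. sqrt (C * t)) \<longlongrightarrow> 0) (at_right 0)"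
      by (auto intro!: tendsto_eq_intros)
  qed
  have bu_lim: "((\<lambda>t. expectation (\<lambda>\<omega>. b t \<omega> * u t \<omega>) / t) \<longlongrightarrow> 0) (at_right 0)"
  proof (rule Lim_null_comparison)
    show "\<forall>\<^sub>F t in at_right 0. norm (expectation (\<lambda>\<omega>. b t \<omega> * u t \<omega>) / t) \<le> (1 + C) * t"
      using near
    proof eventually_elim
      case (elim t)
      \<comment> \<open>The weights \<open>t\<close> and \<open>1 / t\<close> make both resulting terms of order \<open>t\<^sup>2\<close>.\<close>
      have ineq: "\<bar>x * y\<bar> \<le> t * x\<^sup>2 + y\<^sup>2 / t" for x y :: real
      proof -
        have "t * x\<^sup>2 + y\<^sup>2 / t - 2 * \<bar>x * y\<bar> = (t * \<bar>x\<bar> - \<bar>y\<bar>)\<^sup>2 / t"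
          using elim by (simp add: power2_diff abs_mult field_simps power2_eq_square)
        moreover have "0 \<le> (t * \<bar>x\<bar> - \<bar>y\<bar>)\<^sup>2 / t" using elim by simp
        ultimately show ?thesis by linarith
      qed
      have "norm (expectation (\<lambda>\<omega>. b t \<omega> * u t \<omega>)) \<le> expectation (\<lambda>\<omega>. norm (b t \<omega> * u t \<omega>))"
        by (rule integral_norm_bound)
      also have "\<dots> \<le> expectation (\<lambda>\<omega>. t * (b t \<omega>)\<^sup>2 + (u t \<omega>)\<^sup>2 / t)"
        using elim b2 u2 bu ineq by (intro integral_mono integrable_norm) auto
      also have "\<dots> = t * t + expectation (\<lambda>\<omega>. (u t \<omega>)\<^sup>2) / t"
        using elim b2 u2 Eb2 by simp
      also have "\<dots> \<le> t * t + C * t ^ 3 / t"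
        using elim Eu2 by (intro add_left_mono divide_right_mono) auto
      finally show ?case using elim by (simp add: field_simps power3_eq_cube)
    qed
    show "((\<lambda>t. (1 + C) * t) \<longlongrightarrow> 0) (at_right 0)" by (auto intro!: tendsto_eq_intros)
  qed
  have u2_lim: "((\<lambda>t. expectation (\<lambda>\<omega>. (u t \<omega>)\<^sup>2) / t) \<longlongrightarrow> 0) (at_right 0)"
  proof (rule Lim_null_comparison)
    show "\<forall>\<^sub>F t in at_right 0. norm (expectation (\<lambda>\<omega>. (u t \<omega>)\<^sup>2) / t) \<le> C * t\<^sup>2"
      using near
    proof eventually_elim
      case (elim t)
      then show ?case
        using Eu2[of t] by (simp add: field_simps power3_eq_cube power2_eq_square)
    qed
    show "((\<lambda>t. C * t\<^sup>2) \<longlongrightarrow> 0) (at_right 0)" by (auto intro!: tendsto_eq_intros)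
  qed
  have "((\<lambda>t. h - \<alpha> * (expectation (u t) / t)) \<longlongrightarrow> h - \<alpha> * 0) (at_right 0)"
    by (intro tendsto_intros u_lim)
  then have "((\<lambda>t. h - \<alpha> * (expectation (u t) / t)) \<longlongrightarrow> h) (at_right 0)" by simp
  then show "((\<lambda>t. expectation (Z t) / t) \<longlongrightarrow> h) (at_right 0)"
    by (rule Lim_transform_eventually)
      (use near in \<open>eventually_elim, auto simp: EZ diff_divide_distrib\<close>)
  have "((\<lambda>t. \<sigma>\<^sup>2 + t * h\<^sup>2 + \<alpha>\<^sup>2 * (expectation (\<lambda>\<omega>. (u t \<omega>)\<^sup>2) / t)
      - 2 * \<alpha> * \<sigma> * (expectation (\<lambda>\<omega>. b t \<omega> * u t \<omega>) / t)
      - 2 * \<alpha> * t * h * (expectation (u t) / t))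
      \<longlongrightarrow> \<sigma>\<^sup>2 + 0 * h\<^sup>2 + \<alpha>\<^sup>2 * 0 - 2 * \<alpha> * \<sigma> * 0 - 2 * \<alpha> * 0 * h * 0) (at_right 0)"
    by (intro tendsto_intros u_lim bu_lim u2_lim)
  then have "((\<lambda>t. \<sigma>\<^sup>2 + t * h\<^sup>2 + \<alpha>\<^sup>2 * (expectation (\<lambda>\<omega>. (u t \<omega>)\<^sup>2) / t)
      - 2 * \<alpha> * \<sigma> * (expectation (\<lambda>\<omega>. b t \<omega> * u t \<omega>) / t)
      - 2 * \<alpha> * t * h * (expectation (u t) / t)) \<longlongrightarrow> \<sigma>\<^sup>2) (at_right 0)"
    by simp
  then show "((\<lambda>t. expectation (\<lambda>\<omega>. (Z t \<omega>)\<^sup>2) / t) \<longlongrightarrow> \<sigma>\<^sup>2) (at_right 0)"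
  proof (rule Lim_transform_eventually, use near in eventually_elim)
    case (elim t)
    show ?case
      unfolding EZ2[OF conjunct1[OF elim] conjunct2[OF elim]]
      using elim by (simp add: add_divide_distrib diff_divide_distrib power2_eq_square[of t])
  qed
qed

text \<open>The pathwise bound reduces the claim to \<open>t \<integral>\<^sub>0\<^sup>t E (s h + \<sigma> b\<^sub>s)\<^sup>2 ds\<close>. For \<open>s \<le> t < 1\<close> the
  expectation is \<open>s\<^sup>2 h\<^sup>2 + s \<sigma>\<^sup>2 \<le> t (h\<^sup>2 + \<sigma>\<^sup>2)\<close>, which contributes the third factor \<open>t\<close>. The moment
  is a nonnegative Lebesgue integral, so it makes sense before the integral of \<open>z\<close> is known
  to be measurable.\<close>
lemma (in prob_space) drifted_integral_second_moment:
  fixes b z :: "real \<Rightarrow> 'a \<Rightarrow> real"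
  assumes "\<alpha> \<ge> 0"
    and b_meas: "\<And>t. t \<ge> 0 \<Longrightarrow> b t \<in> borel_measurable M"
    and b_cont: "AE \<omega> in M. continuous_on {0..} (\<lambda>t. b t \<omega>)"
    and b2: "\<And>t. t \<ge> 0 \<Longrightarrow> integrable M (\<lambda>\<omega>. (b t \<omega>)\<^sup>2)"
    and Eb: "\<And>t. t \<ge> 0 \<Longrightarrow> expectation (b t) = 0"
    and Eb2: "\<And>t. t \<ge> 0 \<Longrightarrow> expectation (\<lambda>\<omega>. (b t \<omega>)\<^sup>2) = t"
    and z_cont: "AE \<omega> in M. continuous_on {0..} (\<lambda>t. z t \<omega>)"
    and z_eq: "AE \<omega> in M. \<forall>t\<ge>0. z t \<omega> = - \<alpha> * integral {0..t} (\<lambda>s. z s \<omega>) + (t * h + \<sigma> * b t \<omega>)"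
    and t: "0 < t" "t < 1"
  shows "(\<integral>\<^sup>+\<omega>. ennreal ((integral {0..t} (\<lambda>s. z s \<omega>))\<^sup>2) \<partial>M) \<le> ennreal (exp 1 * (h\<^sup>2 + \<sigma>\<^sup>2) * t ^ 3)"
proof -
  define g where "g = (\<lambda>s \<omega>. s * h + \<sigma> * b s \<omega>)"
  have g_meas: "(\<lambda>\<omega>. (g s \<omega>)\<^sup>2) \<in> borel_measurable M" if "s \<ge> 0" for s
    unfolding g_def using b_meas[OF that] by measurable
  have g_cont: "AE \<omega> in M. continuous_on {0..} (\<lambda>s. (g s \<omega>)\<^sup>2)"
    using b_cont by eventually_elim (auto simp: g_def intro!: continuous_intros)
  have Eg2: "(\<integral>\<^sup>+\<omega>. ennreal ((g s \<omega>)\<^sup>2) \<partial>M) \<le> ennreal (t * (h\<^sup>2 + \<sigma>\<^sup>2))" if s: "s \<in> {0..t}" for s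
  proof -
    have b1: "integrable M (b s)"
      by (rule square_integrable_imp_integrable[OF b_meas b2]) (use s in auto)
    have g_sq: "(g s \<omega>)\<^sup>2 = s\<^sup>2 * h\<^sup>2 + 2 * s * h * \<sigma> * b s \<omega> + \<sigma>\<^sup>2 * (b s \<omega>)\<^sup>2" for \<omega>
      unfolding g_def by (simp add: power2_eq_square algebra_simps)
    have "(\<integral>\<^sup>+\<omega>. ennreal ((g s \<omega>)\<^sup>2) \<partial>M) = ennreal (expectation (\<lambda>\<omega>. (g s \<omega>)\<^sup>2))"
    proof (rule nn_integral_eq_integral)
      show "integrable M (\<lambda>\<omega>. (g s \<omega>)\<^sup>2)" using s b1 b2 by (simp add: g_sq)
    qed simp
    also have "expectation (\<lambda>\<omega>. (g s \<omega>)\<^sup>2) = s\<^sup>2 * h\<^sup>2 + \<sigma>\<^sup>2 * s"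
      unfolding g_sq using s b1 b2 by (simp add: Eb Eb2 prob_space)
    also have "\<dots> \<le> t * h\<^sup>2 + \<sigma>\<^sup>2 * t"
    proof (intro add_mono mult_right_mono mult_left_mono)
      have "s * s \<le> t * 1" using s t by (intro mult_mono) auto
      then show "s\<^sup>2 \<le> t" by (simp add: power2_eq_square)
    qed (use s in auto)
    finally show ?thesis by (simp add: algebra_simps ennreal_leI)
  qed

  have "(\<integral>\<^sup>+\<omega>. ennreal ((integral {0..t} (\<lambda>s. z s \<omega>))\<^sup>2) \<partial>M) \<le>
      (\<integral>\<^sup>+\<omega>. ennreal (integral {0..t} (\<lambda>s. exp 1 * t * (g s \<omega>)\<^sup>2)) \<partial>M)"
  proof (rule nn_integral_mono_AE, use b_cont z_cont z_eq in eventually_elim)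
    case (elim \<omega>)
    have "(integral {0..t} (\<lambda>s. z s \<omega>))\<^sup>2 \<le> exp 1 * t * integral {0..t} (\<lambda>s. (g s \<omega>)\<^sup>2)"
      by (rule damped_integral_square_bound[where \<alpha> = \<alpha>])
        (use elim \<open>\<alpha> \<ge> 0\<close> t in \<open>auto simp: g_def intro!: continuous_intros
          intro: continuous_on_subset\<close>)
    then show ?case by (simp add: ennreal_leI)
  qed
  also have "\<dots> = (\<integral>\<^sup>+s\<in>{0..t}. (\<integral>\<^sup>+\<omega>. ennreal (exp 1 * t * (g s \<omega>)\<^sup>2) \<partial>M) \<partial>lborel)"
  proof (rule nn_integral_time_integral)
    show "AE \<omega> in M. continuous_on {0..} (\<lambda>s. exp 1 * t * (g s \<omega>)\<^sup>2)"
      using g_cont by eventually_elim (rule continuous_on_mult_left)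
    show "(\<lambda>\<omega>. exp 1 * t * (g s \<omega>)\<^sup>2) \<in> borel_measurable M" if "s \<ge> 0" for s
      by (intro borel_measurable_times borel_measurable_const g_meas that)
  qed (use t in simp)
  also have "\<dots> \<le> (\<integral>\<^sup>+s\<in>{0..t}. ennreal (exp 1 * t * (t * (h\<^sup>2 + \<sigma>\<^sup>2))) \<partial>lborel)"
  proof (intro nn_integral_mono)
    fix s
    have "(\<integral>\<^sup>+\<omega>. ennreal (exp 1 * t * (g s \<omega>)\<^sup>2) \<partial>M) \<le> ennreal (exp 1 * t * (t * (h\<^sup>2 + \<sigma>\<^sup>2)))"
      if "s \<in> {0..t}"
    proof -
      have "(\<integral>\<^sup>+\<omega>. ennreal (exp 1 * t * (g s \<omega>)\<^sup>2) \<partial>M) =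
          ennreal (exp 1 * t) * (\<integral>\<^sup>+\<omega>. ennreal ((g s \<omega>)\<^sup>2) \<partial>M)"
      proof -
        have "ennreal (exp 1 * t * (g s \<omega>)\<^sup>2) = ennreal (exp 1 * t) * ennreal ((g s \<omega>)\<^sup>2)" for \<omega>
          by (rule ennreal_mult'') simp
        moreover have "(\<lambda>\<omega>. ennreal ((g s \<omega>)\<^sup>2)) \<in> borel_measurable M"
          using that by (intro measurable_compose[OF g_meas measurable_ennreal]) simp
        ultimately show ?thesis by (simp only: nn_integral_cmult)
      qed
      also have "\<dots> \<le> ennreal (exp 1 * t) * ennreal (t * (h\<^sup>2 + \<sigma>\<^sup>2))"
        by (intro mult_left_mono Eg2 that) simp
      also have "\<dots> = ennreal (exp 1 * t * (t * (h\<^sup>2 + \<sigma>\<^sup>2)))"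
        by (rule ennreal_mult''[symmetric]) (use t in simp)
      finally show ?thesis .
    qed
    then show "(\<integral>\<^sup>+\<omega>. ennreal (exp 1 * t * (g s \<omega>)\<^sup>2) \<partial>M) * indicator {0..t} s \<le>
        ennreal (exp 1 * t * (t * (h\<^sup>2 + \<sigma>\<^sup>2))) * indicator {0..t} s"
      by (auto split: split_indicator)
  qed
  also have "\<dots> = ennreal (exp 1 * t * (t * (h\<^sup>2 + \<sigma>\<^sup>2))) * ennreal t"
    using t by (simp add: nn_integral_cmult_indicator)
  also have "\<dots> = ennreal (exp 1 * (h\<^sup>2 + \<sigma>\<^sup>2) * t ^ 3)"
    using t by (subst ennreal_mult''[symmetric]) (simp_all add: power3_eq_cube algebra_simps)
  finally show ?thesis .
qed

section \<open>The stationary second moment of an Ornstein-Uhlenbeck coordinate\<close>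
lemma one_minus_exp_quotient_tendsto:
  "((\<lambda>t::real. (1 - exp (- c * t)) / t) \<longlongrightarrow> c) (at_right 0)"
proof -
  have "((\<lambda>t. 1 - exp (- c * t)) has_real_derivative c) (at 0 within {0<..})"
    by (auto intro!: derivative_eq_intros)
  then show ?thesis by (simp add: has_field_derivative_iff)
qed

text \<open>The process enters only through its solution \<open>z\<close> started at \<open>0\<close>; the initial value is spread by
  \<open>N\<close>. Both conclusions come from one fixed-point equation used twice: at the single time \<open>1/2\<close> it
  gives finiteness of the moment, and in the limit \<open>t \<rightarrow> 0\<close> its value.\<close>
lemma (in prob_space) ornstein_uhlenbeck_stationary_moment:
  fixes b z :: "real \<Rightarrow> 'a \<Rightarrow> real" and N :: "real measure"
  assumes "\<alpha> > 0"
    and b_meas: "\<And>t. t \<ge> 0 \<Longrightarrow> b t \<in> borel_measurable M"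
    and b_cont: "AE \<omega> in M. continuous_on {0..} (\<lambda>t. b t \<omega>)"
    and b2: "\<And>t. t \<ge> 0 \<Longrightarrow> integrable M (\<lambda>\<omega>. (b t \<omega>)\<^sup>2)"
    and Eb: "\<And>t. t \<ge> 0 \<Longrightarrow> expectation (b t) = 0"
    and Eb2: "\<And>t. t \<ge> 0 \<Longrightarrow> expectation (\<lambda>\<omega>. (b t \<omega>)\<^sup>2) = t"
    and z_meas: "\<And>t. t \<ge> 0 \<Longrightarrow> z t \<in> borel_measurable M"
    and z_cont: "AE \<omega> in M. continuous_on {0..} (\<lambda>t. z t \<omega>)"
    and z_eq: "AE \<omega> in M. \<forall>t\<ge>0. z t \<omega> = - \<alpha> * integral {0..t} (\<lambda>s. z s \<omega>) + (t * h + \<sigma> * b t \<omega>)"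
    and N: "prob_space N" "sets N = sets borel"
    and stat: "\<And>t. t > 0 \<Longrightarrow> N = distr (N \<Otimes>\<^sub>M M) borel (\<lambda>(x, \<omega>). exp (- \<alpha> * t) * x + z t \<omega>)"
  shows "integrable N (\<lambda>x. x\<^sup>2)" and "(\<integral>x. x\<^sup>2 \<partial>N) = (h / \<alpha>)\<^sup>2 + \<sigma>\<^sup>2 / (2 * \<alpha>)"
proof -
  \<comment> \<open>Almost surely \<open>u t\<close> is the integral of \<open>z\<close> over \<open>[0, t]\<close>; solving the equation for it gives a
     version that is measurable.\<close>
  define u where "u = (\<lambda>t \<omega>. (\<sigma> * b t \<omega> + t * h - z t \<omega>) / \<alpha>)"
  have z_u: "z t \<omega> = \<sigma> * b t \<omega> + t * h - \<alpha> * u t \<omega>" for t \<omega>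
    using \<open>\<alpha> > 0\<close> by (auto simp: u_def)
  have u_meas: "u t \<in> borel_measurable M" if "t \<ge> 0" for t
    unfolding u_def using b_meas[OF that] z_meas[OF that] by measurable
  have u_bound: "(\<integral>\<^sup>+\<omega>. ennreal ((u t \<omega>)\<^sup>2) \<partial>M) \<le> ennreal (exp 1 * (h\<^sup>2 + \<sigma>\<^sup>2) * t ^ 3)"
    if t: "0 < t" "t < 1" for t
  proof -
    have "(\<integral>\<^sup>+\<omega>. ennreal ((u t \<omega>)\<^sup>2) \<partial>M) = (\<integral>\<^sup>+\<omega>. ennreal ((integral {0..t} (\<lambda>s. z s \<omega>))\<^sup>2) \<partial>M)"
    proof (rule nn_integral_cong_AE, use z_eq in eventually_elim)
      case (elim \<omega>)
      have "z t \<omega> = - \<alpha> * integral {0..t} (\<lambda>s. z s \<omega>) + (t * h + \<sigma> * b t \<omega>)"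
        using t by (intro elim[rule_format]) simp
      then have "u t \<omega> = integral {0..t} (\<lambda>s. z s \<omega>)"
        unfolding u_def using \<open>\<alpha> > 0\<close> by (simp add: field_simps)
      then show ?case by simp
    qed
    also have "\<dots> \<le> ennreal (exp 1 * (h\<^sup>2 + \<sigma>\<^sup>2) * t ^ 3)"
      using \<open>\<alpha> > 0\<close> by (intro drifted_integral_second_moment[OF _ b_meas b_cont b2 Eb Eb2 z_cont z_eq] t) auto
    finally show ?thesis .
  qed
  have u2: "integrable M (\<lambda>\<omega>. (u t \<omega>)\<^sup>2)" if "0 < t" "t < 1" for t
  proof (rule integrableI_nonneg)
    show "(\<lambda>\<omega>. (u t \<omega>)\<^sup>2) \<in> borel_measurable M"
      using u_meas[of t] that by simp
    show "(\<integral>\<^sup>+\<omega>. ennreal ((u t \<omega>)\<^sup>2) \<partial>M) < \<infinity>"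
      using le_less_trans[OF u_bound[OF that] ennreal_less_top] by simp
  qed simp
  have Eu2: "expectation (\<lambda>\<omega>. (u t \<omega>)\<^sup>2) \<le> exp 1 * (h\<^sup>2 + \<sigma>\<^sup>2) * t ^ 3" if "0 < t" "t < 1" for t
    using u_bound[OF that] nn_integral_eq_integral[OF u2[OF that]] that by simp
  have z2: "integrable M (\<lambda>\<omega>. (z t \<omega>)\<^sup>2)" if "0 < t" "t < 1" for t
    using that by (rule small_time_moments(1)[OF z_u b_meas u_meas b2 Eb Eb2 u2 Eu2, rotated -2]) auto
  have z_lim: "((\<lambda>t. expectation (z t) / t) \<longlongrightarrow> h) (at_right 0)"
    by (rule small_time_moments(2)[OF z_u b_meas u_meas b2 Eb Eb2 u2 Eu2]) auto
  have z2_lim: "((\<lambda>t. expectation (\<lambda>\<omega>. (z t \<omega>)\<^sup>2) / t) \<longlongrightarrow> \<sigma>\<^sup>2) (at_right 0)"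
    by (rule small_time_moments(3)[OF z_u b_meas u_meas b2 Eb Eb2 u2 Eu2]) auto
  show X2: "integrable N (\<lambda>x. x\<^sup>2)"
    by (rule affine_stationary_square_integrable[OF N(1) prob_space_axioms N(2)
          z_meas[of "1/2"] z2[of "1/2"] _ _ stat[of "1/2"]])
      (use \<open>\<alpha> > 0\<close> in auto)
  define m where "m = (\<integral>x. x \<partial>N)"
  define q where "q = (\<integral>x. x\<^sup>2 \<partial>N)"
  have near: "\<forall>\<^sub>F t in at_right (0::real). 0 < t \<and> t < 1"
    unfolding eventually_at_right_field by (rule exI[of _ 1]) auto
  have stat_moments: "(1 - exp (- \<alpha> * t)) * m = expectation (z t)"
      "(1 - (exp (- \<alpha> * t))\<^sup>2) * q =
        2 * exp (- \<alpha> * t) * m * expectation (z t) + expectation (\<lambda>\<omega>. (z t \<omega>)\<^sup>2)"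
    if "0 < t" "t < 1" for t
    using affine_stationary_moments[OF N(1) prob_space_axioms N(2) z_meas z2 X2 stat, of t] that
    unfolding m_def q_def by auto
  have m: "\<alpha> * m = h"
  proof (rule tendsto_unique)
    show "((\<lambda>t. expectation (z t) / t) \<longlongrightarrow> h) (at_right 0)" by (rule z_lim)
    have "((\<lambda>t. (1 - exp (- \<alpha> * t)) / t) \<longlongrightarrow> \<alpha>) (at_right 0)"
      by (rule one_minus_exp_quotient_tendsto)
    then have "((\<lambda>t. (1 - exp (- \<alpha> * t)) / t * m) \<longlongrightarrow> \<alpha> * m) (at_right 0)"
      by (rule tendsto_mult_right)
    then show "((\<lambda>t. expectation (z t) / t) \<longlongrightarrow> \<alpha> * m) (at_right 0)"
      by (rule Lim_transform_eventually)
        (use near in \<open>eventually_elim, subst stat_moments(1)[symmetric], auto\<close>)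
  qed simp
  have "2 * \<alpha> * q = 2 * 1 * m * h + \<sigma>\<^sup>2"
  proof (rule tendsto_unique)
    have "((\<lambda>t. exp (- \<alpha> * t)) \<longlongrightarrow> 1) (at_right 0)" by (auto intro!: tendsto_eq_intros)
    then show "((\<lambda>t. 2 * exp (- \<alpha> * t) * m * (expectation (z t) / t)
        + expectation (\<lambda>\<omega>. (z t \<omega>)\<^sup>2) / t) \<longlongrightarrow> 2 * 1 * m * h + \<sigma>\<^sup>2) (at_right 0)"
      by (intro tendsto_intros z_lim z2_lim)
    have "((\<lambda>t. (1 - (exp (- \<alpha> * t))\<^sup>2) / t) \<longlongrightarrow> 2 * \<alpha>) (at_right 0)"
      using one_minus_exp_quotient_tendsto[of "2 * \<alpha>"]
      by (simp add: exp_double[symmetric] mult.assoc)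
    then have "((\<lambda>t. (1 - (exp (- \<alpha> * t))\<^sup>2) / t * q) \<longlongrightarrow> 2 * \<alpha> * q) (at_right 0)"
      by (rule tendsto_mult_right)
    then show "((\<lambda>t. 2 * exp (- \<alpha> * t) * m * (expectation (z t) / t)
        + expectation (\<lambda>\<omega>. (z t \<omega>)\<^sup>2) / t) \<longlongrightarrow> 2 * \<alpha> * q) (at_right 0)"
    proof (rule Lim_transform_eventually, use near in eventually_elim)
      case (elim t)
      have "(1 - (exp (- \<alpha> * t))\<^sup>2) / t * q = (1 - (exp (- \<alpha> * t))\<^sup>2) * q / t" by simp
      also have "\<dots> = 2 * exp (- \<alpha> * t) * m * (expectation (z t) / t)
          + expectation (\<lambda>\<omega>. (z t \<omega>)\<^sup>2) / t"
        using stat_moments(2)[of t] elim by (simp only: add_divide_distrib times_divide_eq_right)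
      finally show ?case .
    qed
  qed simp
  then show "(\<integral>x. x\<^sup>2 \<partial>N) = (h / \<alpha>)\<^sup>2 + \<sigma>\<^sup>2 / (2 * \<alpha>)"
    using \<open>\<alpha> > 0\<close> unfolding q_def[symmetric] m[symmetric]
    by (simp add: field_simps power2_eq_square)
qed


section \<open>Stationary energy of an agent\<close>
lemma (in prob_space) centered_normal_moments:
  assumes "0 < t" and D: "distributed M lborel X (normal_density 0 (sqrt t))"
  shows "integrable M (\<lambda>\<omega>. (X \<omega>)\<^sup>2)" and "expectation X = 0"
    and "expectation (\<lambda>\<omega>. (X \<omega>)\<^sup>2) = t"
proof -
  have "integrable lborel (\<lambda>x. normal_density 0 (sqrt t) x * x\<^sup>2)"
    using normal_moment_even[of "sqrt t" 0 1] \<open>0 < t\<close> by (auto simp: has_bochner_integral_iff)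
  then show "integrable M (\<lambda>\<omega>. (X \<omega>)\<^sup>2)"
    by (subst (asm) distributed_integrable[OF D]) auto
  show E: "expectation X = 0"
    by (rule normal_distributed_expectation[OF _ D]) (use \<open>0 < t\<close> in simp)
  show "expectation (\<lambda>\<omega>. (X \<omega>)\<^sup>2) = t"
    using normal_distributed_variance[OF _ D] \<open>0 < t\<close> by (simp add: E)
qed

text \<open>Although the null set off which \<open>W x\<close> solves the equation depends on \<open>x\<close>, only the law of \<open>W x t\<close>
  for each fixed \<open>x\<close> enters stationarity. Hence \<open>W x t\<close> may be replaced by the jointly measurable
  expression \<open>exp (- \<alpha> t) x + z 0 t\<close> in the integrand, and the stationarity of \<open>\<pi>\<close> becomes a
  fixed-point equation for the law \<open>N\<close> of one coordinate.\<close>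
lemma stationary_coordinate_second_moment:
  fixes M :: "'a measure" and F :: "real \<Rightarrow> 'a measure"
    and B :: "'k::finite \<Rightarrow> real \<Rightarrow> 'a \<Rightarrow> real ^ 'd::finite"
    and W :: "real ^ 'd ^ 'k \<Rightarrow> real \<Rightarrow> 'a \<Rightarrow> real ^ 'd ^ 'k"
    and h :: "real ^ 'd"
  assumes "\<alpha> > 0"
    and filt: "usual_filtered_prob_space M F"
    and BM: "standard_brownian_motion M F (B k)"
    and sde: "\<And>x. decoupled_sde_solution M F B (\<lambda>w. - \<alpha> *\<^sub>R w + h) \<sigma> x (W x)"
    and stat: "stationary_distribution M W \<pi>"
  shows "integrable \<pi> (\<lambda>w. (w $ k $ i)\<^sup>2)"
    and "(\<integral>w. (w $ k $ i)\<^sup>2 \<partial>\<pi>) = (h $ i / \<alpha>)\<^sup>2 + \<sigma>\<^sup>2 / (2 * \<alpha>)"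
proof -
  interpret prob_space M using filt by (simp add: usual_filtered_prob_space_def)
  interpret \<pi>: prob_space \<pi> using stat by (simp add: stationary_distribution_def)
  have \<pi>_sets[measurable_cong]: "sets \<pi> = sets borel"
    using stat by (simp add: stationary_distribution_def)
  have adapted: "f \<in> borel_measurable M" if "t \<ge> 0" "f \<in> borel_measurable (F t)"
    for t and f :: "'a \<Rightarrow> 'b::topological_space"
    using filt that by (auto simp: usual_filtered_prob_space_def intro: measurable_from_subalg)
  have nth_meas[measurable]: "(\<lambda>v :: real ^ 'd. v $ i) \<in> borel_measurable borel" for i :: 'd
    by (intro borel_measurable_continuous_onI continuous_intros)
  have coord_meas[measurable]: "(\<lambda>w :: real ^ 'd ^ 'k. w $ k $ i) \<in> borel_measurable borel"
    by (intro borel_measurable_continuous_onI continuous_intros)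
  \<comment> \<open>Increments from time \<open>0\<close> avoid the null set on which \<open>B k 0\<close> does not vanish.\<close>
  define b where "b = (\<lambda>t \<omega>. (B k t \<omega> - B k 0 \<omega>) $ i)"
  define z where "z = (\<lambda>x t \<omega>. W x t \<omega> $ k $ i)"
  have B_meas: "B k t \<in> borel_measurable M" if "t \<ge> 0" for t
    using BM that by (intro adapted[OF that]) (simp add: standard_brownian_motion_def)
  have b_meas: "b t \<in> borel_measurable M" if "t \<ge> 0" for t
    unfolding b_def using B_meas[OF that] B_meas[of 0]
    by (intro measurable_compose[OF _ nth_meas] borel_measurable_diff) auto
  have b_cont: "AE \<omega> in M. continuous_on {0..} (\<lambda>t. b t \<omega>)"
  proof -
    have "AE \<omega> in M. continuous_on {0..} (\<lambda>t. B k t \<omega>)"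
      using BM by (simp add: standard_brownian_motion_def)
    then show ?thesis
      by eventually_elim (auto simp: b_def intro!: continuous_intros)
  qed
  have b_normal: "distributed M lborel (b t) (normal_density 0 (sqrt t))" if "t > 0" for t
  proof -
    have "distributed M lborel (\<lambda>\<omega>. (B k t \<omega> - B k 0 \<omega>) $ i) (normal_density 0 (sqrt (t - 0)))"
      using BM that unfolding standard_brownian_motion_def by blast
    then show ?thesis by (simp add: b_def)
  qed
  have b_moments: "integrable M (\<lambda>\<omega>. (b t \<omega>)\<^sup>2)" "expectation (b t) = 0"
      "expectation (\<lambda>\<omega>. (b t \<omega>)\<^sup>2) = t" if "t \<ge> 0" for t
  proof -
    have "integrable M (\<lambda>\<omega>. (b t \<omega>)\<^sup>2) \<and> expectation (b t) = 0 \<and> expectation (\<lambda>\<omega>. (b t \<omega>)\<^sup>2) = t"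
    proof (cases "t = 0")
      case True
      then show ?thesis by (simp add: b_def)
    next
      case False
      then show ?thesis using centered_normal_moments[OF _ b_normal, of t] that by simp
    qed
    then show "integrable M (\<lambda>\<omega>. (b t \<omega>)\<^sup>2)" "expectation (b t) = 0"
      "expectation (\<lambda>\<omega>. (b t \<omega>)\<^sup>2) = t" by auto
  qed
  have z_meas: "z x t \<in> borel_measurable M" if "t \<ge> 0" for x t
  proof -
    have "W x t \<in> borel_measurable M"
      using sde that by (intro adapted[OF that]) (simp add: decoupled_sde_solution_def)
    then show ?thesis unfolding z_def by (rule measurable_compose[OF _ coord_meas])
  qed
  have z_cont: "AE \<omega> in M. continuous_on {0..} (\<lambda>t. z x t \<omega>)" for x
  proof -
    have "AE \<omega> in M. continuous_on {0..} (\<lambda>t. W x t \<omega>)"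
      using sde by (simp add: decoupled_sde_solution_def)
    then show ?thesis by eventually_elim (auto simp: z_def intro!: continuous_intros)
  qed
  have z_eq: "AE \<omega> in M. \<forall>t\<ge>0. z x t \<omega> =
      x $ k $ i - \<alpha> * integral {0..t} (\<lambda>s. z x s \<omega>) + (t * h $ i + \<sigma> * b t \<omega>)" for x
  proof -
    have cont: "AE \<omega> in M. continuous_on {0..} (\<lambda>t. W x t \<omega>)"
      and eq: "AE \<omega> in M. \<forall>t\<ge>0. \<forall>k. W x t \<omega> $ k = x $ k +
        integral {0..t} (\<lambda>s. - \<alpha> *\<^sub>R (W x s \<omega> $ k) + h) + \<sigma> *\<^sub>R (B k t \<omega> - B k 0 \<omega>)"
      using sde[of x] unfolding decoupled_sde_solution_def by blast+
    from cont eq show ?thesis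
    proof eventually_elim
      case (elim \<omega>)
      show ?case
      proof (intro allI impI)
        fix t :: real assume t: "t \<ge> 0"
        have c: "continuous_on {0..t} (\<lambda>s. W x s \<omega>)"
          by (rule continuous_on_subset[OF elim(1)]) auto
        have "z x t \<omega> = (x $ k + integral {0..t} (\<lambda>s. - \<alpha> *\<^sub>R (W x s \<omega> $ k) + h)
            + \<sigma> *\<^sub>R (B k t \<omega> - B k 0 \<omega>)) $ i"
          unfolding z_def using elim(2) t by metis
        also have "\<dots> = x $ k $ i + integral {0..t} (\<lambda>s. - \<alpha> *\<^sub>R (W x s \<omega> $ k) + h) $ i + \<sigma> * b t \<omega>"
          by (simp add: b_def)
        also have "integral {0..t} (\<lambda>s. - \<alpha> *\<^sub>R (W x s \<omega> $ k) + h) $ i =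
            integral {0..t} (\<lambda>s. (- \<alpha> *\<^sub>R (W x s \<omega> $ k) + h) $ i)"
          by (intro integral_component_eq_cart[symmetric] integrable_continuous_interval
              continuous_intros c)
        also have "\<dots> = integral {0..t} (\<lambda>s. - \<alpha> * z x s \<omega> + h $ i)"
          by (simp add: z_def)
        also have "\<dots> = integral {0..t} (\<lambda>s. - \<alpha> * z x s \<omega>) + integral {0..t} (\<lambda>s. h $ i)"
          unfolding z_def
          by (intro Henstock_Kurzweil_Integration.integral_add integrable_continuous_interval
              continuous_intros c)
        also have "\<dots> = - \<alpha> * integral {0..t} (\<lambda>s. z x s \<omega>) + t * h $ i"
          using t by simp
        finally show "z x t \<omega> =
            x $ k $ i - \<alpha> * integral {0..t} (\<lambda>s. z x s \<omega>) + (t * h $ i + \<sigma> * b t \<omega>)"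
          by simp
      qed
    qed
  qed
  have z_affine: "AE \<omega> in M. z x t \<omega> = exp (- \<alpha> * t) * x $ k $ i + z 0 t \<omega>" if t: "t \<ge> 0" for x t
    using z_eq[of x] z_eq[of 0] z_cont[of x] z_cont[of 0]
  proof eventually_elim
    case (elim \<omega>)
    have "z x t \<omega> - z 0 t \<omega> = exp (- \<alpha> * t) * x $ k $ i"
    proof (rule linear_integral_equation_solution[where D = "\<lambda>s. z x s \<omega> - z 0 s \<omega>"])
      show "continuous_on {0..} (\<lambda>s. z x s \<omega> - z 0 s \<omega>)"
        by (intro continuous_on_diff elim)
      fix s :: real assume s: "s \<ge> 0"
      have "integral {0..s} (\<lambda>r. z x r \<omega> - z 0 r \<omega>) =
          integral {0..s} (\<lambda>r. z x r \<omega>) - integral {0..s} (\<lambda>r. z 0 r \<omega>)"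
        by (intro Henstock_Kurzweil_Integration.integral_diff integrable_continuous_interval
            continuous_on_subset[OF elim(3)] continuous_on_subset[OF elim(4)]) auto
      then show "z x s \<omega> - z 0 s \<omega> = x $ k $ i - \<alpha> * integral {0..s} (\<lambda>r. z x r \<omega> - z 0 r \<omega>)"
        using elim(1)[rule_format, OF s] elim(2)[rule_format, OF s]
        by (simp only: right_diff_distrib zero_index)
    qed (rule t)
    then show ?case by simp
  qed
  define N where "N = distr \<pi> borel (\<lambda>w. w $ k $ i)"
  have N: "prob_space N" "sets N = sets borel"
    unfolding N_def by (auto intro!: \<pi>.prob_space_distr)
  have coord_meas_\<pi>: "(\<lambda>w. w $ k $ i) \<in> borel_measurable \<pi>" by measurable
  have N_stat: "N = distr (N \<Otimes>\<^sub>M M) borel (\<lambda>(x, \<omega>). exp (- \<alpha> * t) * x + z 0 t \<omega>)"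
    if "t > 0" for t
  proof (rule measure_eqI)
    from that have t: "t \<ge> 0" by simp
    note [measurable] = z_meas[OF t] and [measurable_cong] = N(2)
    fix S assume "S \<in> sets N"
    then have S[measurable]: "S \<in> sets borel" by (simp add: N)
    have S': "(\<lambda>w. w $ k $ i) -` S \<in> sets (borel :: (real ^ 'd ^ 'k) measure)"
      using measurable_sets[OF coord_meas S] by simp
    have "emeasure N S = emeasure \<pi> ((\<lambda>w. w $ k $ i) -` S)"
      unfolding N_def using sets_eq_imp_space_eq[OF \<pi>_sets]
      by (subst emeasure_distr) auto
    also have "\<dots> = (\<integral>\<^sup>+x. emeasure M {\<omega> \<in> space M. W x t \<omega> \<in> (\<lambda>w. w $ k $ i) -` S} \<partial>\<pi>)"
      using stat t S' unfolding stationary_distribution_def by blast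
    also have "\<dots> = (\<integral>\<^sup>+x. emeasure M {\<omega> \<in> space M. exp (- \<alpha> * t) * (x $ k $ i) + z 0 t \<omega> \<in> S} \<partial>\<pi>)"
    proof (rule nn_integral_cong)
      fix x
      have "emeasure M {\<omega> \<in> space M. z x t \<omega> \<in> S} =
          emeasure M {\<omega> \<in> space M. exp (- \<alpha> * t) * (x $ k $ i) + z 0 t \<omega> \<in> S}"
      proof (rule emeasure_eq_AE)
        show "AE \<omega> in M. (\<omega> \<in> {\<omega> \<in> space M. z x t \<omega> \<in> S}) =
            (\<omega> \<in> {\<omega> \<in> space M. exp (- \<alpha> * t) * (x $ k $ i) + z 0 t \<omega> \<in> S})"
          using z_affine[OF t, of x] by eventually_elim simp
        show "{\<omega> \<in> space M. z x t \<omega> \<in> S} \<in> sets M" by measurable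
        show "{\<omega> \<in> space M. exp (- \<alpha> * t) * (x $ k $ i) + z 0 t \<omega> \<in> S} \<in> sets M" by measurable
      qed
      then show "emeasure M {\<omega> \<in> space M. W x t \<omega> \<in> (\<lambda>w. w $ k $ i) -` S} =
          emeasure M {\<omega> \<in> space M. exp (- \<alpha> * t) * (x $ k $ i) + z 0 t \<omega> \<in> S}"
        by (simp add: z_def)
    qed
    also have "\<dots> = (\<integral>\<^sup>+y. emeasure M {\<omega> \<in> space M. exp (- \<alpha> * t) * y + z 0 t \<omega> \<in> S} \<partial>N)"
      unfolding N_def by (rule nn_integral_distr[symmetric, OF coord_meas_\<pi>]) measurable
    also have "\<dots> = emeasure (distr (N \<Otimes>\<^sub>M M) borel (\<lambda>(x, \<omega>). exp (- \<alpha> * t) * x + z 0 t \<omega>)) S"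
    proof -
      have space_N: "space N = UNIV" by (simp add: N_def)
      have "emeasure (distr (N \<Otimes>\<^sub>M M) borel (\<lambda>(x, \<omega>). exp (- \<alpha> * t) * x + z 0 t \<omega>)) S =
          emeasure (N \<Otimes>\<^sub>M M) {p \<in> space (N \<Otimes>\<^sub>M M). exp (- \<alpha> * t) * fst p + z 0 t (snd p) \<in> S}"
        by (subst emeasure_distr) (auto simp: split_beta intro!: arg_cong2[where f = emeasure])
      also have "\<dots> = (\<integral>\<^sup>+y. emeasure M (Pair y -`
          {p \<in> space (N \<Otimes>\<^sub>M M). exp (- \<alpha> * t) * fst p + z 0 t (snd p) \<in> S}) \<partial>N)"
        by (rule emeasure_pair_measure_alt) measurable
      also have "\<dots> = (\<integral>\<^sup>+y. emeasure M {\<omega> \<in> space M. exp (- \<alpha> * t) * y + z 0 t \<omega> \<in> S} \<partial>N)"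
        by (intro nn_integral_cong arg_cong2[where f = emeasure])
          (auto simp: space_pair_measure space_N)
      finally show ?thesis ..
    qed
    finally show "emeasure N S =
        emeasure (distr (N \<Otimes>\<^sub>M M) borel (\<lambda>(x, \<omega>). exp (- \<alpha> * t) * x + z 0 t \<omega>)) S" .
  qed (simp add: N)
  have z_eq0: "AE \<omega> in M. \<forall>t\<ge>0. z 0 t \<omega> =
      - \<alpha> * integral {0..t} (\<lambda>s. z 0 s \<omega>) + (t * h $ i + \<sigma> * b t \<omega>)"
    using z_eq[of 0] by simp
  note moments = ornstein_uhlenbeck_stationary_moment[OF \<open>\<alpha> > 0\<close> b_meas b_cont b_moments z_meas
      z_cont z_eq0 N N_stat]
  have "integrable N (\<lambda>x. x\<^sup>2)" by (rule moments)
  then show "integrable \<pi> (\<lambda>w. (w $ k $ i)\<^sup>2)"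
    unfolding N_def by (subst (asm) integrable_distr_eq[OF coord_meas_\<pi>]) auto
  have "(\<integral>x. x\<^sup>2 \<partial>N) = (h $ i / \<alpha>)\<^sup>2 + \<sigma>\<^sup>2 / (2 * \<alpha>)" by (rule moments)
  then show "(\<integral>w. (w $ k $ i)\<^sup>2 \<partial>\<pi>) = (h $ i / \<alpha>)\<^sup>2 + \<sigma>\<^sup>2 / (2 * \<alpha>)"
    unfolding N_def by (subst (asm) integral_distr[OF coord_meas_\<pi>]) auto
qed

lemma stationary_lyapunov_expectation:
  fixes M :: "'a measure" and F :: "real \<Rightarrow> 'a measure"
    and B :: "'k::finite \<Rightarrow> real \<Rightarrow> 'a \<Rightarrow> real ^ 'd::finite"
    and W :: "real ^ 'd ^ 'k \<Rightarrow> real \<Rightarrow> 'a \<Rightarrow> real ^ 'd ^ 'k"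
    and h :: "real ^ 'd"
  assumes "\<alpha> > 0"
    and "usual_filtered_prob_space M F"
    and "standard_brownian_motion M F (B k)"
    and "\<And>x. decoupled_sde_solution M F B (\<lambda>w. - \<alpha> *\<^sub>R w + h) \<sigma> x (W x)"
    and "stationary_distribution M W \<pi>"
  shows "(\<integral>w. lyapunov k w \<partial>\<pi>) =
    (norm h)\<^sup>2 / (2 * \<alpha>\<^sup>2) + real (CARD('d)) * \<sigma>\<^sup>2 / (4 * \<alpha>)"
proof -
  have norm_sq: "(norm v)\<^sup>2 = (\<Sum>i\<in>UNIV. (v $ i)\<^sup>2)" for v :: "real ^ 'd"
    by (simp add: norm_vec_def L2_set_def sum_nonneg)
  note moments = stationary_coordinate_second_moment[OF assms]
  have "(\<integral>w. lyapunov k w \<partial>\<pi>) = 1/2 * (\<Sum>i\<in>UNIV. \<integral>w. (w $ k $ i)\<^sup>2 \<partial>\<pi>)"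
    unfolding lyapunov_def norm_sq using moments(1) by simp
  also have "\<dots> = 1/2 * ((\<Sum>i\<in>UNIV. (h $ i)\<^sup>2) / \<alpha>\<^sup>2 + real (CARD('d)) * (\<sigma>\<^sup>2 / (2 * \<alpha>)))"
    by (simp add: moments(2) sum.distrib power_divide sum_divide_distrib)
  also have "\<dots> = (norm h)\<^sup>2 / (2 * \<alpha>\<^sup>2) + real (CARD('d)) * \<sigma>\<^sup>2 / (4 * \<alpha>)"
    unfolding norm_sq[symmetric] using \<open>\<alpha> > 0\<close> by (simp add: field_simps)
  finally show ?thesis .
qed

theorem theorem5p1:
  fixes M :: "'a measure" and F :: "real \<Rightarrow> 'a measure"
    and B :: "'k::finite \<Rightarrow> real \<Rightarrow> 'a \<Rightarrow> real ^ 'd::finite"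
    and W W_hon :: "real ^ 'd ^ 'k \<Rightarrow> real \<Rightarrow> 'a \<Rightarrow> real ^ 'd ^ 'k"
    and \<pi> \<pi>_hon :: "(real ^ 'd ^ 'k) measure"
    and h :: "real ^ 'd"
    and \<alpha>_self \<sigma>\<^sub>0 \<theta>_ind \<delta> V_hon :: real
  assumes "CARD('k) \<ge> 2"
    and "\<alpha>_self > 0" and "\<sigma>\<^sub>0 > 0"
    and "usual_filtered_prob_space M F"
    and "\<And>k. standard_brownian_motion M F (B k)"
    and "independent_processes M B"
    and "\<And>x. decoupled_sde_solution M F B (\<lambda>w. - \<alpha>_self *\<^sub>R w + h) \<sigma>\<^sub>0 x (W x)"
    and "stationary_distribution M W \<pi>"
    and "\<And>x. decoupled_sde_solution M F B (\<lambda>w. - \<alpha>_self *\<^sub>R w) \<sigma>\<^sub>0 x (W_hon x)"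
    and "stationary_distribution M W_hon \<pi>_hon"
    and "\<And>k. \<theta>_ind = 2 * (\<integral>w. lyapunov k w \<partial>\<pi>_hon)"
    and "V_hon = honest_noise_floor (CARD('k)) (CARD('d)) \<alpha>_self \<sigma>\<^sub>0"
    and "real (CARD('k)) / (2 * \<alpha>_self\<^sup>2) * (norm h)\<^sup>2 = \<delta> * V_hon"
    and "0 < \<delta>" and "\<delta> < \<theta>_ind / (V_hon / real (CARD('k))) - 1"
  shows "(\<forall>k. (\<integral>w. lyapunov k w \<partial>\<pi>) < \<theta>_ind) \<and> V_joint \<pi> > (1 + \<delta> / 2) * V_hon"
proof -
  define K where "K = real (CARD('k))"
  have K: "K > 0" using assms(1) by (simp add: K_def)
  have floor: "V_hon / K = real (CARD('d)) * \<sigma>\<^sub>0\<^sup>2 / (4 * \<alpha>_self)"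
    using K by (simp add: assms(12) honest_noise_floor_def K_def)
  have V_pos: "V_hon > 0"
  proof -
    have "0 < V_hon / K" unfolding floor using \<open>\<alpha>_self > 0\<close> \<open>\<sigma>\<^sub>0 > 0\<close> by simp
    then show ?thesis using K by (simp add: zero_less_divide_iff)
  qed
  have drift: "(norm h)\<^sup>2 / (2 * \<alpha>_self\<^sup>2) = \<delta> * (V_hon / K)"
    using assms(13) K by (simp add: K_def field_simps)
  have agent: "(\<integral>w. lyapunov k w \<partial>\<pi>) = (1 + \<delta>) * (V_hon / K)" for k
    using stationary_lyapunov_expectation[OF assms(2,4,5,7,8), of k]
    unfolding drift floor[symmetric] by (simp only: distrib_right mult_1 add.commute)
  have "(1 + \<delta>) * (V_hon / K) < \<theta>_ind"
  proof -
    have "1 + \<delta> < \<theta>_ind / (V_hon / K)" using assms(15) unfolding K_def by linarith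
    moreover have "0 < V_hon / K" using V_pos K by simp
    ultimately show ?thesis by (simp only: pos_less_divide_eq)
  qed
  moreover have "V_joint \<pi> = (1 + \<delta>) * V_hon"
    unfolding V_joint_def agent using K by (simp add: K_def)
  moreover have "(1 + \<delta> / 2) * V_hon < (1 + \<delta>) * V_hon"
    using V_pos \<open>0 < \<delta>\<close> by (intro mult_strict_right_mono) auto
  ultimately show ?thesis by (simp add: agent)
qed

end
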